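(* Suppose that, for each $t=1,\dots,T$, $f_t:Q\to\mathbb{R}$ is $M_t$-relatively Lipschitz-continuous and $\mu_t$-strongly convex with respect to the prox-function $h$. Let $d:Q\to\mathbb{R}$ be $M_d$-relatively Lipschitz-continuous and $1$-strongly convex with respect to $h$. Suppose that $d(x)\ge 0$ for all $x\in Q$ and let $A^2=\sup_{x\in Q}d(x)$. Let $x_1,\dots,x_T$ and $\lambda_1,\dots,\lambda_T$ be produced by the adaptive regularized online algorithm described in the context with $\eta_{t+1}=\frac{1}{\mu_{1:t}+\lambda_{1:t}}$. Then $$\mathrm{Regret}_T\le\lambda_{1:T}A^2+\sum_{t=1}^{T}\frac{(M_t+\lambda_tM_d)^2}{\mu_{1:t}+\lambda_{1:t}},$$ and $$\mathrm{Regret}_T\le 2\inf_{\lambda_1^*,\dots,\lambda_T^*}\left((A^2+2M_d^2)\lambda_{1:T}^*+\sum_{t=1}^{T}\frac{(M_t+\lambda_t^*M_d)^2}{\mu_{1:t}+\lambda_{1:t}^*}\right),$$ where the infimum is over $\lambda_1^*,\dots,\lambda_T^*\ge 0$ (with all denominators positive).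
   Context: $Q\subset\mathbb{R}^n$ is a closed convex set, and $h$ is a convex, continuously differentiable function (prox-function), defined on a convex set containing $Q$ and the points $y_{t+1}$ below. Its Bregman divergence is $V(y,x)=h(y)-h(x)-\langle\nabla h(x),y-x\rangle$. For a convex function $f$, $\nabla f(x)$ denotes its (sub)gradient at $x$ (the one used by the algorithm). A convex function $f:Q\to\mathbb{R}$ is $M$-relatively Lipschitz-continuous (with respect to $h$), $M>0$, if $\langle\nabla f(x),y-x\rangle+M\sqrt{2V(y,x)}\ge 0$ for all $x,y\in Q$. A function $f$ is $\mu$-strongly convex with respect to $h$ if $f(x)\ge f(y)+\langle\nabla f(y),x-y\rangle+\mu V(x,y)$ for all $x,y\in Q$. Notation: $\mu_{1:t}=\sum_{s=1}^{t}\mu_s$, $\lambda_{1:t}=\sum_{s=1}^t\lambda_s$, $\lambda^*_{1:t}=\sum_{s=1}^t\lambda^*_s$, and $\mu_{1:0}=\lambda_{1:0}=0$; here $\mu_t\ge 0$ and $A^2<\infty$. Algorithm. Choose $x_1\in Q$ arbitrarily. For $t=1,\dots,T$: predict $x_t$, observe $f_t$, and compute $$\lambda_t=\tfrac12\left(\sqrt{(\mu_{1:t}+\lambda_{1:t-1})^2+\frac{8M_t^2}{A^2+2M_d^2}}-(\mu_{1:t}+\lambda_{1:t-1})\right).$$ Let $y_{t+1}$ be such that $\nabla h(y_{t+1})=\nabla h(x_t)-\eta_{t+1}\big(\nabla f_t(x_t)+\lambda_t\nabla d(x_t)\big)$, and let $x_{t+1}=\arg\min_{x\in Q}V(x,y_{t+1})$.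 (The points $y_{t+1}$ and $x_{t+1}$ are assumed to exist.) The regret is $$\mathrm{Regret}_T=\sum_{t=1}^T f_t(x_t)-\min_{x\in Q}\sum_{t=1}^T f_t(x),$$ where the minimum is assumed to be attained. *)

theory Defs
  imports "HOL-Analysis.Analysis"
begin

text \<open>
  Gradients are passed as explicit functions. For the prox-function, the gradient \<open>gh\<close> is taken
  within its domain \<open>W\<close>, so \<open>W\<close> need not be open; if \<open>W\<close> has empty interior, \<open>gh\<close> may be any
  continuous choice. For the losses and the regularizer, the explicit function is the subgradient
  selection used by the algorithm.
\<close>

definition prox_function :: "'a::euclidean_space set \<Rightarrow> ('a \<Rightarrow> real) \<Rightarrow> ('a \<Rightarrow> 'a) \<Rightarrow> bool" where
  "prox_function W h gh \<longleftrightarrow>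
     convex_on W h \<and>
     (\<forall>x\<in>W. (h has_derivative (\<lambda>v. gh x \<bullet> v)) (at x within W)) \<and>
     continuous_on W gh"

definition bregman ::
  "('a::euclidean_space \<Rightarrow> real) \<Rightarrow> ('a \<Rightarrow> 'a) \<Rightarrow> 'a \<Rightarrow> 'a \<Rightarrow> real" where
  "bregman h gh y x = h y - h x - gh x \<bullet> (y - x)"

definition subgradient_on ::
  "'a::euclidean_space set \<Rightarrow> ('a \<Rightarrow> real) \<Rightarrow> ('a \<Rightarrow> 'a) \<Rightarrow> bool" where
  "subgradient_on Q f gf \<longleftrightarrow> (\<forall>x\<in>Q. \<forall>y\<in>Q. f y \<ge> f x + gf x \<bullet> (y - x))"

definition rel_lipschitz ::
  "'a::euclidean_space set \<Rightarrow> ('a \<Rightarrow> real) \<Rightarrow> ('a \<Rightarrow> 'a) \<Rightarrow> real \<Rightarrow>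
   ('a \<Rightarrow> real) \<Rightarrow> ('a \<Rightarrow> 'a) \<Rightarrow> bool" where
  "rel_lipschitz Q h gh M f gf \<longleftrightarrow>
     M > 0 \<and> convex_on Q f \<and> subgradient_on Q f gf \<and>
     (\<forall>x\<in>Q. \<forall>y\<in>Q. gf x \<bullet> (y - x) + M * sqrt (2 * bregman h gh y x) \<ge> 0)"

definition rel_strongly_convex ::
  "'a::euclidean_space set \<Rightarrow> ('a \<Rightarrow> real) \<Rightarrow> ('a \<Rightarrow> 'a) \<Rightarrow> real \<Rightarrow>
   ('a \<Rightarrow> real) \<Rightarrow> ('a \<Rightarrow> 'a) \<Rightarrow> bool" where
  "rel_strongly_convex Q h gh \<mu> f gf \<longleftrightarrow>
     (\<forall>x\<in>Q. \<forall>y\<in>Q. f x \<ge> f y + gf y \<bullet> (x - y) + \<mu> * bregman h gh x y)"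

abbreviation cumul :: "(nat \<Rightarrow> real) \<Rightarrow> nat \<Rightarrow> real" where
  "cumul a t \<equiv> (\<Sum>s=1..t. a s)"

text \<open>
  A run of the algorithm over rounds \<open>1, \<dots>, T\<close>. Neither \<open>y (t + 1)\<close> nor the Bregman projection
  \<open>x (t + 1)\<close> need be unique (\<open>h\<close> is not assumed strictly convex), so both are constrained by a
  predicate: any admissible choice is allowed.
\<close>

definition adaptive_run ::
  "'a::euclidean_space set \<Rightarrow> 'a set \<Rightarrow> ('a \<Rightarrow> real) \<Rightarrow> ('a \<Rightarrow> 'a) \<Rightarrow>
   (nat \<Rightarrow> 'a \<Rightarrow> 'a) \<Rightarrow> ('a \<Rightarrow> 'a) \<Rightarrow> (nat \<Rightarrow> real) \<Rightarrow> (nat \<Rightarrow> real) \<Rightarrow> real \<Rightarrow> real \<Rightarrow>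
   nat \<Rightarrow> (nat \<Rightarrow> real) \<Rightarrow> (nat \<Rightarrow> real) \<Rightarrow> (nat \<Rightarrow> 'a) \<Rightarrow> (nat \<Rightarrow> 'a) \<Rightarrow> bool" where
  "adaptive_run Q W h gh gf gd M \<mu> M\<^sub>d A T \<eta> lam x y \<longleftrightarrow>
     x 1 \<in> Q \<and>
     (\<forall>t\<in>{1..T}.
        lam t = 1 / 2 * (sqrt ((cumul \<mu> t + cumul lam (t - 1))\<^sup>2
                              + 8 * (M t)\<^sup>2 / (A\<^sup>2 + 2 * M\<^sub>d\<^sup>2))
                        - (cumul \<mu> t + cumul lam (t - 1))) \<and>
        y (t + 1) \<in> W \<and>
        gh (y (t + 1)) = gh (x t) - \<eta> (t + 1) *\<^sub>R (gf t (x t) + lam t *\<^sub>R gd (x t)) \<and>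
        is_arg_min (\<lambda>z. bregman h gh z (y (t + 1))) (\<lambda>z. z \<in> Q) (x (t + 1)))"

text \<open>The infimum is the minimum whenever the latter is attained, which is assumed where it is used.\<close>

definition regret ::
  "'a set \<Rightarrow> (nat \<Rightarrow> 'a \<Rightarrow> real) \<Rightarrow> (nat \<Rightarrow> 'a) \<Rightarrow> nat \<Rightarrow> real" where
  "regret Q f x T = (\<Sum>t=1..T. f t (x t)) - (INF z\<in>Q. \<Sum>t=1..T. f t z)"

end

theory Submission
  imports Defs
begin

text \<open>
  Each round is a mirror descent step on \<open>f\<^sub>t + \<lambda>\<^sub>t d\<close>, whose relative strong convexity makes
  the Bregman terms telescope for the weights \<open>s\<^sub>t = \<mu>\<^bsub>1:t\<^esub> + \<lambda>\<^bsub>1:t\<^esub>\<close>. This gives the first bound,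
  with a factor \<open>1 / 2\<close> to spare in the second sum.

  Let \<open>B = A\<^sup>2 + 2 M\<^sub>d\<^sup>2\<close>. The choice of \<open>\<lambda>\<^sub>t\<close> means \<open>B \<lambda>\<^sub>t s\<^sub>t = 2 M\<^sub>t\<^sup>2\<close>. The spare factor alone does not
  give the constant \<open>2\<close> of the second bound: one also needs that \<open>d\<close>, being both relatively
  Lipschitz and relatively strongly convex, oscillates by at most \<open>M\<^sub>d\<^sup>2 / 2\<close>, so that
  \<open>d z - d x\<^sub>t\<close> is at most \<open>B / 5\<close>. The regret is then at most the sum of
  \<open>B \<lambda>\<^sub>t (7 / 10 + \<lambda>\<^sub>t / (2 s\<^sub>t))\<close>, which is compared with any competitor by induction on \<open>T\<close>.
\<close>

section \<open>Bregman divergences and first-order conditions\<close>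

text \<open>\<open>F'\<close> is only a derivative within \<open>S\<close>, which may have empty
  interior. Along the segment from \<open>x\<close> to \<open>z\<close>, which stays in
  \<open>S\<close> by convexity, its value is still a limit of difference quotients, and each of
  these is at most \<open>c\<close>.\<close>

lemma directional_derivative_le:
  fixes F :: "'a::real_normed_vector \<Rightarrow> real"
  assumes "(F has_derivative F') (at x within S)" and "convex S" "x \<in> S" "z \<in> S"
    and le: "\<And>t. \<lbrakk>0 < t; t \<le> 1\<rbrakk> \<Longrightarrow> F (x + t *\<^sub>R (z - x)) - F x \<le> t * c"
  shows "F' (z - x) \<le> c"
proof -
  define p where "p = (\<lambda>t::real. x + t *\<^sub>R (z - x))"
  have "p t \<in> S" if "t \<in> {0..1}" for t
  proof -
    have "p t = (1 - t) *\<^sub>R x + t *\<^sub>R z"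
      by (simp add: p_def algebra_simps)
    then show ?thesis
      using assms that by (auto intro!: convexD_alt)
  qed
  then have "p ` {0..1} \<subseteq> S" by blast
  moreover have p0: "p 0 = x" by (simp add: p_def)
  ultimately have "(F has_derivative F') (at (p 0) within p ` {0..1})"
    using has_derivative_subset[OF assms(1)] by simp
  moreover have "(p has_derivative (\<lambda>t. t *\<^sub>R (z - x))) (at 0 within {0..1})"
    unfolding p_def by (auto intro!: derivative_eq_intros)
  ultimately have "(F \<circ> p has_derivative F' \<circ> (\<lambda>t. t *\<^sub>R (z - x))) (at 0 within {0..1})"
    by (rule diff_chain_within[rotated])
  moreover have "F' \<circ> (\<lambda>t. t *\<^sub>R (z - x)) = (\<lambda>t. F' (z - x) * t)"
    using has_derivative_bounded_linear[OF assms(1)]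
    by (auto simp: fun_eq_iff linear_cmul bounded_linear.linear)
  ultimately have "(F \<circ> p has_field_derivative F' (z - x)) (at 0 within {0..1})"
    by (simp add: has_field_derivative_def)
  then have lim: "((\<lambda>t. (F (p t) - F x) / t) \<longlongrightarrow> F' (z - x)) (at 0 within {0..1})"
    by (simp add: has_field_derivative_iff p0)
  have "(F (p t) - F x) / t \<le> c" if "0 < t" "t \<le> 1" for t
    using le[OF that] that by (simp add: p_def pos_divide_le_eq mult.commute)
  then have "\<forall>\<^sub>F t in at 0 within {0..1}. (F (p t) - F x) / t \<le> c"
    by (auto simp: eventually_at intro!: exI[of _ 1])
  moreover have "at (0::real) within {0..1} \<noteq> bot"
    by (simp add: trivial_limit_within)
  ultimately show ?thesis
    using tendsto_upperbound[OF lim] by blast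
qed

lemma bregman_nonneg:
  assumes "prox_function W h gh" "x \<in> W" "y \<in> W"
  shows "0 \<le> bregman h gh y x"
proof -
  have cvx: "convex_on W h" and der: "(h has_derivative (\<lambda>v. gh x \<bullet> v)) (at x within W)"
    using assms by (auto simp: prox_function_def)
  have "gh x \<bullet> (y - x) \<le> h y - h x"
  proof (rule directional_derivative_le[OF der convex_on_imp_convex[OF cvx] assms(2,3)])
    fix t :: real assume t: "0 < t" "t \<le> 1"
    have "h ((1 - t) *\<^sub>R x + t *\<^sub>R y) \<le> (1 - t) * h x + t * h y"
      using convex_onD[OF cvx, of t x y] t assms by simp
    then show "h (x + t *\<^sub>R (y - x)) - h x \<le> t * (h y - h x)"
      by (simp add: algebra_simps)
  qed
  then show ?thesis by (simp add: bregman_def)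
qed

text \<open>The two sides differ by \<open>(gh p - gh y) \<bullet> (z - p)\<close>, which is
  nonnegative by first-order optimality of \<open>p\<close> along the segment towards
  \<open>z\<close>. The sign is flipped below because minimality of the divergence bounds its
  negative from above.\<close>

lemma bregman_projection:
  assumes prox: "prox_function W h gh" and Q: "Q \<subseteq> W" "convex Q"
    and min: "is_arg_min (\<lambda>z. bregman h gh z y) (\<lambda>z. z \<in> Q) p" and z: "z \<in> Q"
  shows "bregman h gh z p + bregman h gh p y \<le> bregman h gh z y"
proof -
  have le: "bregman h gh p y \<le> bregman h gh w y" if "w \<in> Q" for w
    using min that by (simp add: is_arg_min_def not_less)
  have p: "p \<in> Q" using min by (simp add: is_arg_min_def)
  have "(h has_derivative (\<lambda>v. gh p \<bullet> v)) (at p within Q)"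
    using prox p Q by (auto simp: prox_function_def intro: has_derivative_subset)
  then have der: "((\<lambda>w. - bregman h gh w y) has_derivative (\<lambda>v. - (gh p \<bullet> v - gh y \<bullet> v)))
      (at p within Q)"
    unfolding bregman_def by (auto intro!: derivative_eq_intros)
  have "- (gh p \<bullet> (z - p) - gh y \<bullet> (z - p)) \<le> 0"
  proof (rule directional_derivative_le[OF der Q(2) p z])
    fix t :: real assume t: "0 < t" "t \<le> 1"
    have "(1 - t) *\<^sub>R p + t *\<^sub>R z \<in> Q"
      using t p z Q by (auto intro!: convexD_alt)
    then have "p + t *\<^sub>R (z - p) \<in> Q" by (simp add: algebra_simps)
    from le[OF this] show "- bregman h gh (p + t *\<^sub>R (z - p)) y - - bregman h gh p y \<le> t * 0"
      by simp
  qed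
  then show ?thesis by (simp add: bregman_def algebra_simps)
qed

section \<open>One round of mirror descent\<close>

lemma mirror_step:
  assumes prox: "prox_function W h gh" and Q: "Q \<subseteq> W" "convex Q"
    and x: "x \<in> Q" and y: "y \<in> W" and z: "z \<in> Q"
    and grad: "gh y = gh x - (1 / s) *\<^sub>R g" and s: "0 < s"
    and min: "is_arg_min (\<lambda>w. bregman h gh w y) (\<lambda>w. w \<in> Q) p"
    and lip: "\<And>w. w \<in> Q \<Longrightarrow> 0 \<le> g \<bullet> (w - x) + K * sqrt (2 * bregman h gh w x)"
  shows "g \<bullet> (x - z) \<le> s * (bregman h gh z x - bregman h gh z p) + K\<^sup>2 / (2 * s)"
proof -
  have p: "p \<in> Q" using min by (simp add: is_arg_min_def)
  define r where "r = sqrt (2 * bregman h gh p x)"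
  have V: "bregman h gh p x = r\<^sup>2 / 2"
    using bregman_nonneg[OF prox, of x p] x p Q by (simp add: r_def subset_iff)
  have g: "g = s *\<^sub>R (gh x - gh y)"
    using grad s by simp
  have "g \<bullet> (x - z) = s * (bregman h gh z x - bregman h gh z y + bregman h gh x y)"
    unfolding g bregman_def by (simp add: algebra_simps)
  also have "\<dots> \<le> s * (bregman h gh z x - bregman h gh z p
      + (bregman h gh x y - bregman h gh p y))"
    using bregman_projection[OF prox Q min z] s by simp
  \<comment> \<open>Going back from \<open>y\<close> to \<open>x\<close> brings out the penalty
    \<open>- s * bregman h gh p x\<close>, quadratic in \<open>r\<close>, which absorbs the linear
    growth \<open>K * r\<close> allowed by the Lipschitz condition.\<close>
  also have "\<dots> = s * (bregman h gh z x - bregman h gh z p)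
      + (g \<bullet> (x - p) - s * bregman h gh p x)"
    unfolding g bregman_def by (simp add: algebra_simps)
  also have "g \<bullet> (x - p) - s * bregman h gh p x \<le> K * r - s * r\<^sup>2 / 2"
    using lip[OF p, folded r_def] unfolding V by (simp add: inner_diff_right)
  also have "\<dots> \<le> K\<^sup>2 / (2 * s)"
  proof -
    have "K\<^sup>2 / (2 * s) - (K * r - s * r\<^sup>2 / 2) = (K - s * r)\<^sup>2 / (2 * s)"
      using s by (simp add: field_simps power2_eq_square)
    moreover have "0 \<le> (K - s * r)\<^sup>2 / (2 * s)" using s by simp
    ultimately show ?thesis by linarith
  qed
  finally show ?thesis by simp
qed

text \<open>Both conditions are used with the gradient at \<open>z\<close>: with
  \<open>r\<^sup>2 / 2\<close> the divergence of \<open>x\<close> from \<open>z\<close>, the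
  difference is at most \<open>K * r - r\<^sup>2 / 2\<close>, whose maximum does not depend on the
  points.\<close>

lemma rel_lipschitz_strongly_convex_oscillation:
  assumes prox: "prox_function W h gh" and Q: "Q \<subseteq> W" and x: "x \<in> Q" and z: "z \<in> Q"
    and lip: "rel_lipschitz Q h gh K d gd" and sc: "rel_strongly_convex Q h gh 1 d gd"
  shows "d z - d x \<le> K\<^sup>2 / 2"
proof -
  define r where "r = sqrt (2 * bregman h gh x z)"
  have V: "bregman h gh x z = r\<^sup>2 / 2"
    using bregman_nonneg[OF prox, of z x] x z Q by (simp add: r_def subset_iff)
  have "d x \<ge> d z + gd z \<bullet> (x - z) + 1 * bregman h gh x z"
    using sc x z unfolding rel_strongly_convex_def by blast
  moreover have "gd z \<bullet> (x - z) + K * r \<ge> 0"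
    using lip x z unfolding rel_lipschitz_def r_def by blast
  moreover have "K * r - r\<^sup>2 / 2 \<le> K\<^sup>2 / 2"
    using zero_le_power2[of "K - r"] by (simp add: power2_diff)
  ultimately show ?thesis using V by simp
qed

section \<open>Comparison with an arbitrary competitor\<close>

text \<open>
  If \<open>cumul a T\<close> is at most \<open>5 / 3\<close> times \<open>cumul l T\<close>, the first term on the right pays for
  everything; otherwise the last round pays for itself.
\<close>

lemma adaptive_competitive:
  fixes a l m :: "nat \<Rightarrow> real"
  assumes "\<And>t. t \<in> {1..T} \<Longrightarrow> 0 < a t" "\<And>t. t \<in> {1..T} \<Longrightarrow> 0 \<le> l t"
    "\<And>t. t \<in> {1..T} \<Longrightarrow> 0 \<le> m t" "\<And>t. t \<in> {1..T} \<Longrightarrow> 0 < cumul m t + cumul l t"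
  shows "(\<Sum>t=1..T. a t * (7 / 10 + a t / (2 * (cumul m t + cumul a t))))
    \<le> 2 * cumul l T
      + (\<Sum>t=1..T. a t * (cumul m t + cumul a t) / (cumul m t + cumul l t))"
  using assms
proof (induction T)
  case 0
  then show ?case by simp
next
  case (Suc T)
  define s where "s t = cumul m t + cumul a t" for t
  define u where "u t = cumul m t + cumul l t" for t
  have s_ge: "a t \<le> s t" and s_pos: "0 < s t" if "t \<in> {1..Suc T}" for t
  proof -
    have "a t \<le> cumul a t"
      using that Suc.prems(1) by (intro member_le_sum) (auto intro: less_imp_le)
    moreover have "0 \<le> cumul m t"
      using that Suc.prems(3) by (intro sum_nonneg) auto
    ultimately show "a t \<le> s t" by (simp add: s_def)
    with Suc.prems(1)[OF that] show "0 < s t" by simp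
  qed
  show ?case
  \<comment> \<open>Here \<open>6 / 5\<close> is \<open>7 / 10 + 1 / 2\<close>, the largest value of
    the bracket, since \<open>a t \<le> s t\<close>.\<close>
  proof (cases "6 / 5 * cumul a (Suc T) \<le> 2 * cumul l (Suc T)")
    case True
    have "(\<Sum>t=1..Suc T. a t * (7 / 10 + a t / (2 * s t))) \<le> (\<Sum>t=1..Suc T. 6 / 5 * a t)"
    proof (rule sum_mono)
      fix t assume t: "t \<in> {1..Suc T}"
      have "a t / (2 * s t) \<le> 1 / 2"
        using s_ge[OF t] s_pos[OF t] by (simp add: field_simps)
      then have "a t * (7 / 10 + a t / (2 * s t)) \<le> a t * (6 / 5)"
        using Suc.prems(1)[OF t] by (intro mult_left_mono) auto
      then show "a t * (7 / 10 + a t / (2 * s t)) \<le> 6 / 5 * a t" by simp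
    qed
    also have "\<dots> = 6 / 5 * cumul a (Suc T)" by (simp only: sum_distrib_left)
    also have "\<dots> \<le> 2 * cumul l (Suc T)" by (rule True)
    also have "\<dots> \<le> 2 * cumul l (Suc T) + (\<Sum>t=1..Suc T. a t * s t / u t)"
    proof -
      have "0 \<le> a t * s t / u t" if "t \<in> {1..Suc T}" for t
        using Suc.prems(1)[OF that] Suc.prems(4)[OF that] s_pos[OF that]
        by (simp add: u_def)
      then have "0 \<le> (\<Sum>t=1..Suc T. a t * s t / u t)" by (rule sum_nonneg)
      then show ?thesis by linarith
    qed
    finally show ?thesis by (simp only: s_def u_def)
  next
    case False
    let ?a = "a (Suc T)" and ?s = "s (Suc T)" and ?u = "u (Suc T)"
    have a: "0 < ?a" "?a \<le> ?s" "0 < ?s" and u: "0 < ?u"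
      unfolding u_def by (intro Suc.prems(1,4) s_ge s_pos; simp)+
    have "?a \<le> cumul a (Suc T)"
      using Suc.prems(1) by (intro member_le_sum) (auto intro: less_imp_le)
    \<comment> \<open>In this case \<open>cumul l (Suc T)\<close> is below \<open>3 / 5\<close> of
      \<open>cumul a (Suc T)\<close>, so \<open>?u\<close> falls short of \<open>?s\<close> by at
      least \<open>2 / 5\<close> of the last increment.\<close>
    then have us: "?u \<le> ?s - 2 / 5 * ?a"
      using False unfolding s_def u_def by linarith
    have "(7 / 10 + ?a / (2 * ?s)) * ?u \<le> (7 / 10 + ?a / (2 * ?s)) * (?s - 2 / 5 * ?a)"
      using us a by (intro mult_left_mono) auto
    also have "\<dots> = 7 / 10 * ?s + 22 / 100 * ?a - ?a\<^sup>2 / (5 * ?s)"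
      using a by (simp add: field_simps power2_eq_square)
    also have "\<dots> \<le> ?s"
    proof -
      have "0 \<le> ?a\<^sup>2 / (5 * ?s)" using a by simp
      with a show ?thesis by linarith
    qed
    finally have "7 / 10 + ?a / (2 * ?s) \<le> ?s / ?u"
      using u by (simp add: pos_le_divide_eq)
    from mult_left_mono[OF this, of ?a] have "?a * (7 / 10 + ?a / (2 * ?s)) \<le> ?a * ?s / ?u"
      using a by simp
    moreover have "(\<Sum>t=1..T. a t * (7 / 10 + a t / (2 * s t)))
        \<le> 2 * cumul l T + (\<Sum>t=1..T. a t * s t / u t)"
      unfolding s_def u_def by (rule Suc.IH) (use Suc.prems in auto)
    moreover have "cumul l T \<le> cumul l (Suc T)"
      using Suc.prems(2) by simp
    ultimately have "(\<Sum>t=1..Suc T. a t * (7 / 10 + a t / (2 * s t)))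
        \<le> 2 * cumul l (Suc T) + (\<Sum>t=1..Suc T. a t * s t / u t)"
      by simp
    then show ?thesis by (simp only: s_def u_def)
  qed
qed

section \<open>Regret of the adaptive algorithm\<close>

theorem theorem3:
  fixes Q W :: "'a::euclidean_space set"
    and h d :: "'a \<Rightarrow> real" and f :: "nat \<Rightarrow> 'a \<Rightarrow> real"
    and gh gd :: "'a \<Rightarrow> 'a" and gf :: "nat \<Rightarrow> 'a \<Rightarrow> 'a"
    and M \<mu> \<eta> lam :: "nat \<Rightarrow> real" and M\<^sub>d A :: real
    and x y :: "nat \<Rightarrow> 'a" and T :: nat
  assumes "closed Q" and "convex Q" and "Q \<subseteq> W"
    and "prox_function W h gh"
    and "\<And>t. t \<in> {1..T} \<Longrightarrow> \<mu> t \<ge> 0"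
    and "\<And>t. t \<in> {1..T} \<Longrightarrow> rel_lipschitz Q h gh (M t) (f t) (gf t)"
    and "\<And>t. t \<in> {1..T} \<Longrightarrow> rel_strongly_convex Q h gh (\<mu> t) (f t) (gf t)"
    and "rel_lipschitz Q h gh M\<^sub>d d gd"
    and "rel_strongly_convex Q h gh 1 d gd"
    and "\<And>z. z \<in> Q \<Longrightarrow> d z \<ge> 0"
    and "bdd_above (d ` Q)" and "A\<^sup>2 = (SUP z\<in>Q. d z)"
    and "adaptive_run Q W h gh gf gd M \<mu> M\<^sub>d A T \<eta> lam x y"
    and "\<And>t. t \<in> {1..T} \<Longrightarrow> \<eta> (t + 1) = 1 / (cumul \<mu> t + cumul lam t)"
    and "\<exists>z. is_arg_min (\<lambda>z. \<Sum>t=1..T. f t z) (\<lambda>z. z \<in> Q) z"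
  shows "regret Q f x T
           \<le> cumul lam T * A\<^sup>2
              + (\<Sum>t=1..T. (M t + lam t * M\<^sub>d)\<^sup>2 / (cumul \<mu> t + cumul lam t))
       \<and> regret Q f x T
           \<le> 2 * (INF l\<in>{l. \<forall>t\<in>{1..T}. l t \<ge> 0 \<and> cumul \<mu> t + cumul l t > 0}.
                    (A\<^sup>2 + 2 * M\<^sub>d\<^sup>2) * cumul l T
                    + (\<Sum>t=1..T. (M t + l t * M\<^sub>d)\<^sup>2 / (cumul \<mu> t + cumul l t)))"
proof -
  note Qc = assms(2) and QW = assms(3) and prox = assms(4) and mu = assms(5)
    and lip = assms(6) and sc = assms(7) and lipd = assms(8) and scd = assms(9)
    and run = assms(13) and eta = assms(14)
  define B where "B = A\<^sup>2 + 2 * M\<^sub>d\<^sup>2"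
  define s where "s t = cumul \<mu> t + cumul lam t" for t
  have Md: "0 < M\<^sub>d" and M: "\<And>t. t \<in> {1..T} \<Longrightarrow> 0 < M t"
    using lipd lip by (auto simp: rel_lipschitz_def)
  have B: "0 < B" using Md by (simp add: B_def add_nonneg_pos)
  have lam_eq: "lam t = 1 / 2 * (sqrt ((cumul \<mu> t + cumul lam (t - 1))\<^sup>2 + 8 * (M t)\<^sup>2 / B)
      - (cumul \<mu> t + cumul lam (t - 1)))" if "t \<in> {1..T}" for t
    using run that unfolding adaptive_run_def B_def by blast
  have s_rec: "s t = cumul \<mu> t + cumul lam (t - 1) + lam t" if "t \<in> {1..T}" for t
    using that by (cases t) (auto simp: s_def)
  \<comment> \<open>\<open>lam t\<close> is the larger root of
    \<open>X\<^sup>2 + b * X = e / 4\<close>, and \<open>s t = b + lam t\<close>. It is positive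
    whatever the sign of \<open>b\<close>, so no induction over the rounds is needed.\<close>
  have lam_pos: "0 < lam t" and lam_s: "B * lam t * s t = 2 * (M t)\<^sup>2" if t: "t \<in> {1..T}" for t
  proof -
    define b where "b = cumul \<mu> t + cumul lam (t - 1)"
    define e where "e = 8 * (M t)\<^sup>2 / B"
    have e: "0 < e" using M[OF t] B by (simp add: e_def)
    have l: "2 * lam t + b = sqrt (b\<^sup>2 + e)"
      using lam_eq[OF t] by (simp add: b_def e_def)
    have "\<bar>b\<bar> < sqrt (b\<^sup>2 + e)" using e by (intro real_less_rsqrt) simp
    then show "0 < lam t" using l by linarith
    have "(2 * lam t + b)\<^sup>2 = b\<^sup>2 + e" unfolding l using e by (simp add: add_nonneg_pos less_imp_le)
    then have "4 * (lam t * (b + lam t)) = e" by (simp add: power2_eq_square algebra_simps)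
    then have "lam t * s t = e / 4" using s_rec[OF t] by (simp add: b_def)
    then show "B * lam t * s t = 2 * (M t)\<^sup>2" using B by (simp add: e_def field_simps)
  qed
  have s_ge: "lam t \<le> s t" and s_pos: "0 < s t" if t: "t \<in> {1..T}" for t
  proof -
    have "0 \<le> cumul \<mu> t" using mu t by (intro sum_nonneg) auto
    moreover have "lam t \<le> cumul lam t"
      using t lam_pos by (intro member_le_sum) (auto intro: less_imp_le)
    ultimately show "lam t \<le> s t" by (simp add: s_def)
    with lam_pos[OF t] show "0 < s t" by simp
  qed
  \<comment> \<open>The range includes \<open>T + 1\<close> because the telescoped sum ends with a
    divergence from \<open>x (Suc T)\<close>.\<close>
  have xQ: "x t \<in> Q" if "t \<in> {1..T + 1}" for t
  proof (cases "t = 1")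
    case True
    then show ?thesis using run unfolding adaptive_run_def by blast
  next
    case False
    then have "t - 1 \<in> {1..T}" "t - 1 + 1 = t" using that by auto
    then show ?thesis using run unfolding adaptive_run_def is_arg_min_def by metis
  qed
  obtain z where z: "is_arg_min (\<lambda>z. \<Sum>t=1..T. f t z) (\<lambda>z. z \<in> Q) z"
    using assms(15) by blast
  then have zQ: "z \<in> Q" by (simp add: is_arg_min_def)
  have "(\<Sum>t=1..T. f t z) \<le> (INF w\<in>Q. \<Sum>t=1..T. f t w)"
    using z zQ by (intro cINF_greatest) (auto simp: is_arg_min_def not_less)
  then have "regret Q f x T \<le> (\<Sum>t=1..T. f t (x t) - f t z)"
    by (simp add: regret_def sum_subtractf)
  also have "\<dots> \<le> (\<Sum>t=1..T. (s (t - 1) * bregman h gh z (x t) - s t * bregman h gh z (x (Suc t)))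
      + (lam t * (d z - d (x t)) + (M t + lam t * M\<^sub>d)\<^sup>2 / (2 * s t)))"
  proof (rule sum_mono)
    fix t assume t: "t \<in> {1..T}"
    have xt: "x t \<in> Q" using t xQ by simp
    let ?g = "gf t (x t) + lam t *\<^sub>R gd (x t)"
    have "?g \<bullet> (x t - z) \<le> s t * (bregman h gh z (x t) - bregman h gh z (x (t + 1)))
        + (M t + lam t * M\<^sub>d)\<^sup>2 / (2 * s t)"
    proof (rule mirror_step[OF prox QW Qc xt _ zQ])
      show "y (t + 1) \<in> W" "gh (y (t + 1)) = gh (x t) - (1 / s t) *\<^sub>R ?g"
        "is_arg_min (\<lambda>w. bregman h gh w (y (t + 1))) (\<lambda>w. w \<in> Q) (x (t + 1))"
        using run t unfolding adaptive_run_def eta[OF t, folded s_def, symmetric] by blast+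
      show "0 < s t" using t by (rule s_pos)
      fix w assume w: "w \<in> Q"
      let ?r = "sqrt (2 * bregman h gh w (x t))"
      have "0 \<le> gf t (x t) \<bullet> (w - x t) + M t * ?r" "0 \<le> gd (x t) \<bullet> (w - x t) + M\<^sub>d * ?r"
        using lip[OF t] lipd w xt unfolding rel_lipschitz_def by blast+
      then have "0 \<le> (gf t (x t) \<bullet> (w - x t) + M t * ?r)
          + lam t * (gd (x t) \<bullet> (w - x t) + M\<^sub>d * ?r)"
        using lam_pos[OF t] by simp
      then show "0 \<le> ?g \<bullet> (w - x t) + (M t + lam t * M\<^sub>d) * ?r"
        by (simp add: inner_add_left algebra_simps)
    qed
    moreover have "f t z \<ge> f t (x t) + gf t (x t) \<bullet> (z - x t) + \<mu> t * bregman h gh z (x t)"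
      using sc[OF t] zQ xt unfolding rel_strongly_convex_def by blast
    moreover have "lam t * d z \<ge> lam t * (d (x t) + gd (x t) \<bullet> (z - x t)
        + 1 * bregman h gh z (x t))"
      using scd zQ xt lam_pos[OF t] unfolding rel_strongly_convex_def
      by (intro mult_left_mono) auto
    \<comment> \<open>The strong convexity of \<open>f t\<close> and of \<open>lam t\<close> times
      \<open>d\<close> subtracts \<open>\<mu> t + lam t\<close> copies of the divergence from
      \<open>x t\<close>. This lowers its weight from \<open>s t\<close> to
      \<open>s (t - 1)\<close>, so the sum telescopes.\<close>
    moreover have "s t = s (t - 1) + \<mu> t + lam t"
      using t by (cases t) (auto simp: s_def)
    then have "s t * bregman h gh z (x t) = s (t - 1) * bregman h gh z (x t)
        + \<mu> t * bregman h gh z (x t) + lam t * bregman h gh z (x t)"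
      by (simp add: distrib_right)
    ultimately show "f t (x t) - f t z
        \<le> (s (t - 1) * bregman h gh z (x t) - s t * bregman h gh z (x (Suc t)))
          + (lam t * (d z - d (x t)) + (M t + lam t * M\<^sub>d)\<^sup>2 / (2 * s t))"
      by (simp add: inner_add_left inner_diff_right algebra_simps)
  qed
  also have "\<dots> = (s 0 * bregman h gh z (x 1) - s T * bregman h gh z (x (Suc T)))
      + (\<Sum>t=1..T. lam t * (d z - d (x t)) + (M t + lam t * M\<^sub>d)\<^sup>2 / (2 * s t))"
  proof -
    have "(\<Sum>t=1..n. s (t - 1) * bregman h gh z (x t) - s t * bregman h gh z (x (Suc t)))
        = s 0 * bregman h gh z (x 1) - s n * bregman h gh z (x (Suc n))" for n
      by (induction n) auto
    then show ?thesis by (simp only: sum.distrib)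
  qed
  \<comment> \<open>The weight \<open>s 0\<close> is an empty sum, so the arbitrary starting point
    costs nothing; the final divergence enters with a minus sign and is dropped.\<close>
  also have "\<dots> \<le> (\<Sum>t=1..T. lam t * (d z - d (x t)) + (M t + lam t * M\<^sub>d)\<^sup>2 / (2 * s t))"
  proof -
    have "0 \<le> s T" using s_pos[of T] by (cases T) (auto simp: s_def)
    moreover have "0 \<le> bregman h gh z (x (Suc T))"
      using bregman_nonneg[OF prox] zQ xQ[of "Suc T"] QW by auto
    moreover have "s 0 = 0" by (simp add: s_def)
    ultimately show ?thesis by simp
  qed
  finally have regret: "regret Q f x T
      \<le> (\<Sum>t=1..T. lam t * (d z - d (x t)) + (M t + lam t * M\<^sub>d)\<^sup>2 / (2 * s t))" .
  have d_le: "d z - d (x t) \<le> A\<^sup>2" if "t \<in> {1..T}" for t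
  proof -
    have "d z \<le> A\<^sup>2" using zQ assms(11,12) by (simp add: cSUP_upper)
    moreover have "0 \<le> d (x t)" using assms(10) xQ that by simp
    ultimately show ?thesis by simp
  qed
  have "(\<Sum>t=1..T. lam t * (d z - d (x t)) + (M t + lam t * M\<^sub>d)\<^sup>2 / (2 * s t))
      \<le> (\<Sum>t=1..T. lam t * A\<^sup>2 + (M t + lam t * M\<^sub>d)\<^sup>2 / s t)"
  proof (rule sum_mono)
    fix t assume t: "t \<in> {1..T}"
    have "lam t * (d z - d (x t)) \<le> lam t * A\<^sup>2"
      using d_le[OF t] lam_pos[OF t] by (intro mult_left_mono) auto
    moreover have "(M t + lam t * M\<^sub>d)\<^sup>2 / (2 * s t) \<le> (M t + lam t * M\<^sub>d)\<^sup>2 / s t"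
      using s_pos[OF t] by (intro divide_left_mono) auto
    ultimately show "lam t * (d z - d (x t)) + (M t + lam t * M\<^sub>d)\<^sup>2 / (2 * s t)
        \<le> lam t * A\<^sup>2 + (M t + lam t * M\<^sub>d)\<^sup>2 / s t" by simp
  qed
  with regret have first: "regret Q f x T
      \<le> cumul lam T * A\<^sup>2 + (\<Sum>t=1..T. (M t + lam t * M\<^sub>d)\<^sup>2 / s t)"
    by (simp add: sum.distrib sum_distrib_right)
  have "(\<Sum>t=1..T. lam t * (d z - d (x t)) + (M t + lam t * M\<^sub>d)\<^sup>2 / (2 * s t))
      \<le> (\<Sum>t=1..T. B * (lam t * (7 / 10 + lam t / (2 * s t))))"
  proof (rule sum_mono)
    fix t assume t: "t \<in> {1..T}"
    note pos = lam_pos[OF t] s_pos[OF t]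
    have "d z - d (x t) \<le> M\<^sub>d\<^sup>2 / 2"
      using rel_lipschitz_strongly_convex_oscillation[OF prox QW _ zQ lipd scd] xQ t by simp
    \<comment> \<open>Take \<open>1 / 5\<close> of the bound \<open>A\<^sup>2\<close> and
      \<open>4 / 5\<close> of the bound \<open>M\<^sub>d\<^sup>2 / 2\<close>.\<close>
    with d_le[OF t] have "d z - d (x t) \<le> B / 5" unfolding B_def by simp
    then have "lam t * (d z - d (x t)) \<le> lam t * (B / 5)"
      using pos by (intro mult_left_mono) auto
    \<comment> \<open>After splitting the square, \<open>2 * (M t)\<^sup>2\<close> becomes
      \<open>B * lam t * s t\<close> and \<open>2 * M\<^sub>d\<^sup>2\<close> is at most
      \<open>B\<close>. The resulting \<open>1 / 2\<close> joins the \<open>1 / 5\<close> above to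
      give \<open>7 / 10\<close>.\<close>
    moreover have "(M t + lam t * M\<^sub>d)\<^sup>2 / (2 * s t) \<le> B * lam t / 2 + B * (lam t)\<^sup>2 / (2 * s t)"
    proof -
      have "(M t + lam t * M\<^sub>d)\<^sup>2 \<le> 2 * (M t)\<^sup>2 + (2 * M\<^sub>d\<^sup>2) * (lam t)\<^sup>2"
        using zero_le_power2[of "M t - lam t * M\<^sub>d"]
        by (simp add: power2_eq_square algebra_simps)
      also have "\<dots> \<le> B * lam t * s t + B * (lam t)\<^sup>2"
        unfolding lam_s[OF t] by (intro add_left_mono mult_right_mono) (auto simp: B_def)
      finally have "(M t + lam t * M\<^sub>d)\<^sup>2 / (2 * s t)
          \<le> (B * lam t * s t + B * (lam t)\<^sup>2) / (2 * s t)"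
        using pos by (intro divide_right_mono) auto
      also have "\<dots> = B * lam t / 2 + B * (lam t)\<^sup>2 / (2 * s t)"
        using pos by (simp add: add_divide_distrib)
      finally show ?thesis .
    qed
    ultimately show "lam t * (d z - d (x t)) + (M t + lam t * M\<^sub>d)\<^sup>2 / (2 * s t)
        \<le> B * (lam t * (7 / 10 + lam t / (2 * s t)))"
      by (simp add: algebra_simps power2_eq_square)
  qed
  with regret have regret': "regret Q f x T
      \<le> B * (\<Sum>t=1..T. lam t * (7 / 10 + lam t / (2 * s t)))"
    by (simp add: sum_distrib_left)
  have second: "regret Q f x T / 2 \<le> (INF l\<in>{l. \<forall>t\<in>{1..T}. l t \<ge> 0 \<and> cumul \<mu> t + cumul l t > 0}.
      B * cumul l T + (\<Sum>t=1..T. (M t + l t * M\<^sub>d)\<^sup>2 / (cumul \<mu> t + cumul l t)))"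
  proof (rule cINF_greatest)
    show "{l. \<forall>t\<in>{1..T}. l t \<ge> 0 \<and> cumul \<mu> t + cumul l t > 0} \<noteq> {}"
      \<comment> \<open>The sequence \<open>lam\<close> of the run is itself an admissible
        competitor.\<close>
      using lam_pos s_pos by (auto simp: s_def intro!: exI[of _ lam] less_imp_le)
  next
    fix l assume "l \<in> {l. \<forall>t\<in>{1..T}. l t \<ge> 0 \<and> cumul \<mu> t + cumul l t > 0}"
    then have l: "0 \<le> l t" and u: "0 < cumul \<mu> t + cumul l t" if "t \<in> {1..T}" for t
      using that by auto
    note regret'
    also have "B * (\<Sum>t=1..T. lam t * (7 / 10 + lam t / (2 * s t)))
        \<le> B * (2 * cumul l T + (\<Sum>t=1..T. lam t * s t / (cumul \<mu> t + cumul l t)))"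
      unfolding s_def using B lam_pos l mu u
      by (intro mult_left_mono adaptive_competitive) auto
    also have "\<dots> = 2 * (B * cumul l T)
        + (\<Sum>t=1..T. B * lam t * s t / (cumul \<mu> t + cumul l t))"
      by (simp add: distrib_left sum_distrib_left mult_ac)
    \<comment> \<open>The numerator \<open>B * lam t * s t\<close> is
      \<open>2 * (M t)\<^sup>2\<close>, and enlarging \<open>M t\<close> to
      \<open>M t + l t * M\<^sub>d\<close> yields the competitor's own cost.\<close>
    also have "\<dots> \<le> 2 * (B * cumul l T)
        + (\<Sum>t=1..T. 2 * ((M t + l t * M\<^sub>d)\<^sup>2 / (cumul \<mu> t + cumul l t)))"
    proof (intro add_left_mono sum_mono)
      fix t assume t: "t \<in> {1..T}"
      have "(M t)\<^sup>2 \<le> (M t + l t * M\<^sub>d)\<^sup>2"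
        using M[OF t] l[OF t] Md by (intro power_mono) auto
      then show "B * lam t * s t / (cumul \<mu> t + cumul l t)
          \<le> 2 * ((M t + l t * M\<^sub>d)\<^sup>2 / (cumul \<mu> t + cumul l t))"
        unfolding lam_s[OF t] using u[OF t] by (simp add: divide_right_mono)
    qed
    finally show "regret Q f x T / 2 \<le> B * cumul l T
        + (\<Sum>t=1..T. (M t + l t * M\<^sub>d)\<^sup>2 / (cumul \<mu> t + cumul l t))"
      unfolding sum_distrib_left[symmetric] by linarith
  qed
  show ?thesis
    using first second unfolding s_def B_def by linarith
qed

end
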